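(* Let $A$ be a symmetric $N\times N$ matrix with integer entries, let $t=(t_1,\dots,t_N)$ be variables, and let $$f_A(t,q)=\sum_{n\in\mathbb{Z}_{\ge0}^N}\frac{(-1)^{\mathrm{diag}(A)\cdot n}\,q^{\frac12(n^tAn+\mathrm{diag}(A)\cdot n)}}{(q;q)_{n_1}\cdots(q;q)_{n_N}}\,t_1^{n_1}\cdots t_N^{n_N}\in\mathbb{Q}(q)[\![t]\!],\qquad f^{\mathrm{sym}}_A(t,q)=f_A(t,q)\,f_A(t,q^{-1}).$$ Then $$f_A^{\mathrm{sym}}(t,q)=\sum_{k\in\mathbb{Z}_{\ge0}^N}(-1)^{\mathrm{diag}(A-I)k}\,q^{-k^t(A-I)k/2-\mathrm{diag}(A-I)k/2}\prod_{j=1}^N\begin{bmatrix}(Ak)_j+A_{jj}-1\\ k_j\end{bmatrix}_q t_1^{k_1}\cdots t_N^{k_N}.$$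
   Context: Notation: $(q;q)_k=\prod_{i=1}^k(1-q^i)$; for a square matrix $M$ and vector $k$, $\mathrm{diag}(M)k=\sum_jM_{jj}k_j$; $I$ is the identity matrix. $f_A(t,q^{-1})$ is obtained by substituting $q\mapsto q^{-1}$ in the coefficients in $\mathbb{Q}(q)$. For $a\in\mathbb{Z}$ (possibly negative) and $b\in\mathbb{Z}_{\ge0}$ the $q$-binomial is $\begin{bmatrix}a\\ b\end{bmatrix}_q=\prod_{i=0}^{b-1}\frac{1-q^{a-i}}{1-q^{i+1}}$. *)

theory Defs
  imports "HOL-Analysis.Analysis" "HOL-Computational_Algebra.Polynomial_Factorial"
    "HOL-Computational_Algebra.Field_as_Ring"
begin

section \<open>The field of rational functions in q\<close>

type_synonym ratfun = "rat poly fract"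

definition q :: ratfun where
  "q = to_fract [:0, 1:]"

definition poly_at :: "rat poly \<Rightarrow> ratfun \<Rightarrow> ratfun" where
  "poly_at p x = poly (map_poly (\<lambda>c. to_fract [:c:]) p) x"

text \<open>The substitution of the inverse of q for q. It does not depend on the chosen
  representation as a quotient of polynomials, see \<open>subst_qinv_Fract\<close> below.\<close>

definition subst_qinv :: "ratfun \<Rightarrow> ratfun" where
  "subst_qinv r = (case quot_of_fract r of (a, b) \<Rightarrow> poly_at a (inverse q) / poly_at b (inverse q))"

lemma q_nonzero: "q \<noteq> 0"
  by (simp add: q_def)

lemma poly_at_0 [simp]: "poly_at 0 x = 0"
  by (simp add: poly_at_def)

lemma poly_at_pCons: "poly_at (pCons c p) x = to_fract [:c:] + x * poly_at p x"
  by (cases "c = 0 \<and> p = 0") (auto simp: poly_at_def map_poly_pCons)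

lemma poly_at_q: "poly_at p q = to_fract p"
proof (induction p)
  case 0
  then show ?case by simp
next
  case (pCons c p)
  have "to_fract [:c:] + q * to_fract p = to_fract ([:c:] + [:0, 1:] * p)"
    unfolding q_def by (simp only: to_fract_add to_fract_mult)
  then show ?case
    by (simp add: poly_at_pCons pCons.IH)
qed

lemma poly_at_add: "poly_at (p + p') x = poly_at p x + poly_at p' x"
proof -
  have "map_poly (\<lambda>c. to_fract [:c:]) (p + p')
      = map_poly (\<lambda>c. to_fract [:c:]) p + map_poly (\<lambda>c. to_fract [:c:]) p'"
    by (rule poly_eqI) (simp add: coeff_map_poly flip: to_fract_add)
  then show ?thesis by (simp add: poly_at_def)
qed

lemma poly_at_smult: "poly_at (smult c p) x = to_fract [:c:] * poly_at p x"
proof -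
  have "map_poly (\<lambda>c. to_fract [:c:]) (smult c p)
      = smult (to_fract [:c:]) (map_poly (\<lambda>c. to_fract [:c:]) p)"
    by (rule poly_eqI) (simp add: coeff_map_poly flip: to_fract_mult)
  then show ?thesis by (simp add: poly_at_def)
qed

lemma poly_at_mult: "poly_at (p * p') x = poly_at p x * poly_at p' x"
  by (induction p) (simp_all add: poly_at_pCons poly_at_add poly_at_smult algebra_simps)

lemma poly_at_qinv_nonzero:
  assumes "p \<noteq> 0"
  shows "poly_at p (inverse q) \<noteq> 0"
proof -
  define P where "P = map_poly (\<lambda>c. to_fract [:c:]) p"
  have eq: "reflect_poly P = map_poly (\<lambda>c. to_fract [:c:]) (reflect_poly p)"
    by (rule poly_eqI) (simp add: P_def coeff_reflect_poly coeff_map_poly degree_map_poly)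
  have "q ^ degree P * poly P (inverse q) = poly (reflect_poly P) q"
    by (simp add: poly_reflect_poly_nz q_nonzero)
  also have "\<dots> = poly_at (reflect_poly p) q"
    by (simp add: eq poly_at_def)
  also have "\<dots> \<noteq> 0"
    using assms by (simp add: poly_at_q)
  finally show ?thesis by (auto simp: P_def poly_at_def)
qed

lemma subst_qinv_Fract:
  assumes "b \<noteq> 0"
  shows "subst_qinv (Fract a b) = poly_at a (inverse q) / poly_at b (inverse q)"
proof -
  obtain c d where cd: "quot_of_fract (Fract a b) = (c, d)"
    by (cases "quot_of_fract (Fract a b)")
  have d: "d \<noteq> 0"
    using snd_quot_of_fract_nonzero[of "Fract a b"] by (simp add: cd)
  have "Fract c d = Fract a b"
    using Fract_quot_of_fract[of "Fract a b"] by (simp add: cd)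
  then have "c * b = a * d"
    using assms d by (simp add: eq_fract)
  then have "poly_at c (inverse q) * poly_at b (inverse q) = poly_at a (inverse q) * poly_at d (inverse q)"
    by (metis poly_at_mult)
  then show ?thesis
    by (simp add: subst_qinv_def cd frac_eq_eq poly_at_qinv_nonzero assms d)
qed


section \<open>Formal power series in variables indexed by a finite type\<close>

typedef ('a, 'n::finite) mfps = "UNIV :: (nat ^ 'n \<Rightarrow> 'a) set"
  morphisms mfps_coeff Abs_mfps
  by simp

instantiation mfps :: (comm_semiring_1, finite) times
begin

definition times_mfps :: "('a, 'b) mfps \<Rightarrow> ('a, 'b) mfps \<Rightarrow> ('a, 'b) mfps" where
  "F * G = Abs_mfps (\<lambda>k. \<Sum>(m, l) | m + l = k. mfps_coeff F m * mfps_coeff G l)"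

instance ..

end

text \<open>The sum in the product above is a finite one.\<close>

lemma finite_vec_sum_eq: "finite {(m, l). m + l = (k :: nat ^ 'n)}"
proof -
  define B where "B = (UNIV :: 'n set) \<rightarrow>\<^sub>E {..Max (range (($) k))}"
  have *: "x \<in> vec_lambda ` B" if "\<forall>i. x $ i \<le> k $ i" for x
  proof (rule image_eqI[of _ _ "($) x"])
    show "($) x \<in> B"
      using that by (auto simp: B_def intro: order_trans[OF _ Max_ge])
  qed simp
  have "{(m, l). m + l = k} \<subseteq> vec_lambda ` B \<times> vec_lambda ` B"
    by (auto intro!: *)
  moreover have "finite (vec_lambda ` B \<times> vec_lambda ` B)"
    by (simp add: B_def finite_PiE)
  ultimately show ?thesis by (rule finite_subset)
qed

definition map_mfps :: "('a \<Rightarrow> 'b) \<Rightarrow> ('a, 'n::finite) mfps \<Rightarrow> ('b, 'n) mfps" where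
  "map_mfps h F = Abs_mfps (\<lambda>n. h (mfps_coeff F n))"


section \<open>The series attached to a matrix\<close>

definition qpoch :: "nat \<Rightarrow> ratfun" where
  "qpoch k = (\<Prod>i=1..k. 1 - q ^ i)"

definition qbinom :: "int \<Rightarrow> nat \<Rightarrow> ratfun" where
  "qbinom a b = (\<Prod>i<b. (1 - q powi (a - int i)) / (1 - q ^ (i + 1)))"

definition int_vec :: "nat ^ 'n \<Rightarrow> int ^ 'n" where
  "int_vec k = (\<chi> i. int (k $ i))"

definition diag_dot :: "int ^ 'n ^ 'n \<Rightarrow> nat ^ 'n \<Rightarrow> int" where
  "diag_dot M k = (\<Sum>j\<in>UNIV. M $ j $ j * int (k $ j))"

definition quad_form :: "int ^ 'n ^ 'n \<Rightarrow> nat ^ 'n \<Rightarrow> int" where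
  "quad_form M k = (\<Sum>i\<in>UNIV. int_vec k $ i * (M *v int_vec k) $ i)"

text \<open>For symmetric matrices the following number is even, so the exponents of q
  below, written with \<open>div 2\<close>, are exact halves.\<close>

lemma even_quad_form_plus_diag_dot:
  assumes "transpose M = M"
  shows "even (quad_form M k + diag_dot M k)"
proof -
  have sym: "M $ i $ j = M $ j $ i" for i j
    using assms by (metis transpose_def vec_lambda_beta)
  define x where "x = (\<lambda>i. int (k $ i))"
  have "even ((\<Sum>i\<in>S. \<Sum>j\<in>S. M $ i $ j * x i * x j) + (\<Sum>i\<in>S. M $ i $ i * x i))"
    if "finite S" for S
    using that
  proof (induction S)
    case (insert s S)
    have "(\<Sum>i\<in>S. M $ i $ s * x i * x s) = (\<Sum>j\<in>S. M $ s $ j * x s * x j)"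
      by (rule sum.cong) (simp_all add: sym[of _ s])
    then have "(\<Sum>i\<in>insert s S. \<Sum>j\<in>insert s S. M $ i $ j * x i * x j) + (\<Sum>i\<in>insert s S. M $ i $ i * x i)
      = ((\<Sum>i\<in>S. \<Sum>j\<in>S. M $ i $ j * x i * x j) + (\<Sum>i\<in>S. M $ i $ i * x i))
        + 2 * (\<Sum>j\<in>S. M $ s $ j * x s * x j) + M $ s $ s * (x s * (x s + 1))"
      using insert.hyps by (simp add: sum.distrib algebra_simps)
    then show ?case
      using insert.IH by simp
  qed simp
  from this[of UNIV] show ?thesis
    by (simp add: quad_form_def diag_dot_def int_vec_def matrix_vector_mult_def x_def
        sum_distrib_left mult_ac)
qed

definition f_series :: "int ^ 'n ^ 'n \<Rightarrow> (ratfun, 'n) mfps" where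
  "f_series A = Abs_mfps (\<lambda>n.
     (-1) powi diag_dot A n * q powi ((quad_form A n + diag_dot A n) div 2)
       / (\<Prod>i\<in>UNIV. qpoch (n $ i)))"

definition f_sym :: "int ^ 'n ^ 'n \<Rightarrow> (ratfun, 'n) mfps" where
  "f_sym A = f_series A * map_mfps subst_qinv (f_series A)"

end

theory Submission
  imports Defs
begin

text \<open>
  Fix an exponent vector \<open>k\<close>. The coefficient of the product series at \<open>k\<close> is a sum over
  \<open>m + l = k\<close>, where \<open>l\<close> comes from the factor with q inverted. In that factor the quadratic
  exponent of q changes its sign, and by symmetry of \<open>A\<close>
  \[ m^t A m - l^t A l = k^t A k - 2\, l^t A k, \]
  so the two quadratic exponents combine into one that is linear in \<open>l\<close>
  (\<open>half_exponent_diff\<close>). Inverting q in a q-factorial only contributes a sign and the power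
  \<open>q ^ (l (l + 1) / 2)\<close> for each coordinate (\<open>subst_qinv_qpoch\<close>). Every summand is therefore a
  product over the coordinates of factors that depend on one \<open>l $ j\<close> each (\<open>f_sym_term\<close>), and the
  sum over \<open>l\<close> is a product of one-variable sums (\<open>sum_vec_splittings\<close>).

  With \<open>c = (A k)_j + A_jj\<close>, the sum for the coordinate \<open>j\<close> is the left-hand side of the
  q-binomial theorem at \<open>x = q powi (1 - c)\<close>. The theorem turns it into a product that is, up to a
  sign and a power of q, the q-binomial coefficient with upper entry \<open>c - 1\<close>
  (\<open>q_binomial_theorem_qbinom\<close>). The signs and powers that are split off on the way are exactly
  what changes \<open>A\<close> into \<open>A - mat 1\<close> and inverts the remaining power of q
  (\<open>half_exponent_minus_identity\<close>).
\<close>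

section \<open>The substitution of the inverse of q is a field homomorphism\<close>

lemma poly_at_one [simp]: "poly_at 1 x = 1"
  using poly_at_pCons[of 1 0 x] by (simp flip: one_pCons)

lemma subst_qinv_one [simp]: "subst_qinv 1 = 1"
  by (simp add: One_fract_def subst_qinv_Fract)

lemma subst_qinv_zero [simp]: "subst_qinv 0 = 0"
  by (simp add: Zero_fract_def subst_qinv_Fract)

lemma subst_qinv_mult: "subst_qinv (x * y) = subst_qinv x * subst_qinv y"
  by (cases x, cases y) (simp add: subst_qinv_Fract poly_at_mult)

lemma subst_qinv_add: "subst_qinv (x + y) = subst_qinv x + subst_qinv y"
  by (cases x, cases y)
    (simp add: subst_qinv_Fract poly_at_mult poly_at_add poly_at_qinv_nonzero add_frac_eq)

lemma subst_qinv_uminus: "subst_qinv (- x) = - subst_qinv x"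
  by (metis add_eq_0_iff neg_eq_iff_add_eq_0 subst_qinv_add subst_qinv_zero)

lemma subst_qinv_diff: "subst_qinv (x - y) = subst_qinv x - subst_qinv y"
  using subst_qinv_add[of x "- y"] by (simp add: subst_qinv_uminus)

lemma subst_qinv_inverse: "subst_qinv (inverse x) = inverse (subst_qinv x)"
proof (cases "x = 0")
  case False
  then have "subst_qinv x * subst_qinv (inverse x) = 1"
    by (simp flip: subst_qinv_mult)
  then show ?thesis by (metis inverse_unique)
qed simp

lemma subst_qinv_divide: "subst_qinv (x / y) = subst_qinv x / subst_qinv y"
  by (simp add: divide_inverse subst_qinv_mult subst_qinv_inverse)

lemma subst_qinv_power: "subst_qinv (x ^ n) = subst_qinv x ^ n"
  by (induction n) (simp_all add: subst_qinv_mult)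

lemma subst_qinv_powi: "subst_qinv (x powi n) = subst_qinv x powi n"
  by (simp add: power_int_def subst_qinv_power subst_qinv_inverse)

lemma subst_qinv_prod: "subst_qinv (\<Prod>i\<in>S. g i) = (\<Prod>i\<in>S. subst_qinv (g i))"
  by (induction S rule: infinite_finite_induct) (simp_all add: subst_qinv_mult)

lemma subst_qinv_q [simp]: "subst_qinv q = inverse q"
proof -
  have "subst_qinv q = poly_at [:0, 1:] (inverse q)"
    using subst_qinv_Fract[of 1 "[:0, 1:]"] by (simp add: q_def to_fract_def)
  then show ?thesis
    by (simp add: poly_at_pCons flip: one_pCons)
qed


section \<open>q-factorials and the q-binomial theorem\<close>

text \<open>The indeterminate q is not a root of unity: a power of the polynomial \<open>[:0, 1:]\<close> with positive
  exponent has positive degree.\<close>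

lemma one_minus_q_power_nonzero:
  assumes "i > 0"
  shows "1 - q ^ i \<noteq> 0"
proof
  assume "1 - q ^ i = 0"
  moreover have "q ^ i = to_fract ([:0, 1:] ^ i)"
    by (induction i) (simp_all add: q_def to_fract_mult del: mult_pCons_left)
  ultimately have "to_fract ([:0, 1:] ^ i) = to_fract (1 :: rat poly)"
    by simp
  then have "([:0, 1:] :: rat poly) ^ i = 1"
    by (simp only: to_fract_eq_iff)
  then have "degree (([:0, 1:] :: rat poly) ^ i) = 0"
    by simp
  with assms show False by (simp add: degree_power_eq)
qed

lemma qpoch_0 [simp]: "qpoch 0 = 1"
  by (simp add: qpoch_def)

lemma qpoch_Suc: "qpoch (Suc n) = (1 - q ^ Suc n) * qpoch n"
  by (simp add: qpoch_def mult.commute)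

lemma qpoch_nonzero [simp]: "qpoch n \<noteq> 0"
  using one_minus_q_power_nonzero by (auto simp: qpoch_def)

lemma Suc_choose_two: "(Suc l choose 2) = l + (l choose 2)"
  by (simp add: numeral_2_eq_2)

text \<open>Each factor satisfies \<open>1 - q ^ (- i) = - (1 - q ^ i) / q ^ i\<close>; the exponents
  \<open>1 + \<dots> + n\<close> add up to \<open>Suc n choose 2\<close>.\<close>

lemma subst_qinv_qpoch: "subst_qinv (qpoch n) = (-1) ^ n * qpoch n / q ^ (Suc n choose 2)"
proof (induction n)
  case (Suc n)
  have "subst_qinv (1 - q ^ Suc n) = - (1 - q ^ Suc n) / q ^ Suc n"
    by (simp add: subst_qinv_diff subst_qinv_power field_simps q_nonzero del: power_Suc)
  then show ?case
    unfolding qpoch_Suc subst_qinv_mult Suc.IH Suc_choose_two[of "Suc n"] power_add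
    by (simp del: power_Suc) (simp add: algebra_simps)
qed (simp add: numeral_2_eq_2)

text \<open>This is the q-Pascal recurrence, divided by \<open>qpoch n\<close>. It comes from
  \<open>1 - q ^ Suc n = (1 - q ^ (n - l)) + q ^ (n - l) * (1 - q ^ Suc l)\<close>, where each of the two summands
  cancels the last factor of one of the two q-factorials.\<close>

lemma q_pascal:
  assumes "l < n"
  shows "(1 - q ^ Suc n) / (qpoch (Suc l) * qpoch (n - l))
    = 1 / (qpoch (Suc l) * qpoch (n - Suc l)) + q ^ (n - l) / (qpoch l * qpoch (n - l))"
proof -
  obtain d where n: "n = l + Suc d"
    using assms less_iff_Suc_add by auto
  have nz: "1 - q ^ Suc l \<noteq> 0" "1 - q ^ Suc d \<noteq> 0"
    by (rule one_minus_q_power_nonzero, simp)+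
  have "q ^ Suc n = q ^ Suc d * q ^ Suc l"
    by (simp add: n power_add)
  then have "1 - q ^ Suc n = (1 - q ^ Suc d) + q ^ Suc d * (1 - q ^ Suc l)"
    by (simp add: algebra_simps del: power_Suc)
  note split = this
  have d: "n - l = Suc d" "n - Suc l = d"
    by (simp_all add: n)
  show ?thesis
    unfolding split d qpoch_Suc add_divide_distrib using nz by (simp del: power_Suc)
qed

text \<open>The form due to Gauss, by induction on \<open>n\<close>: the q-Pascal recurrence says that passing from
  \<open>n\<close> to \<open>Suc n\<close> multiplies the generating polynomial of the q-binomial coefficients by
  \<open>1 - x * q ^ n\<close>.\<close>

theorem q_binomial_theorem:
  "(\<Sum>l\<le>n. (-1) ^ l * q ^ (l choose 2) * x ^ l / (qpoch l * qpoch (n - l)))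
     = (\<Prod>i<n. 1 - x * q ^ i) / qpoch n"
proof (induction n)
  case 0
  then show ?case by (simp add: numeral_2_eq_2)
next
  case (Suc n)
  define c where "c = (\<lambda>l. (-1) ^ l * q ^ (l choose 2) * x ^ l)"
  define b where "b = (\<lambda>n l. c l / (qpoch l * qpoch (n - l)))"
  have nz: "1 - q ^ Suc n \<noteq> 0"
    by (rule one_minus_q_power_nonzero) simp
  have c_Suc: "c (Suc l) = - (x * q ^ l * c l)" for l
    by (simp add: c_def Suc_choose_two power_add)
  have step: "(1 - q ^ Suc n) * b (Suc n) (Suc l) = b n (Suc l) - x * q ^ n * b n l" if "l < n" for l
  proof -
    have "q ^ n = q ^ l * q ^ (n - l)"
      using that by (simp flip: power_add)
    moreover have "(1 - q ^ Suc n) * b (Suc n) (Suc l)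
      = c (Suc l) * ((1 - q ^ Suc n) / (qpoch (Suc l) * qpoch (n - l)))"
      by (simp add: b_def)
    ultimately show ?thesis
      unfolding q_pascal[OF that] by (simp add: b_def c_Suc algebra_simps)
  qed
  \<comment> \<open>The two ends of the row, where only one of the two neighbours in the row above exists.\<close>
  have first: "(1 - q ^ Suc n) * b (Suc n) 0 = b n 0"
    using nz by (simp add: b_def qpoch_Suc)
  have last: "(1 - q ^ Suc n) * b (Suc n) (Suc n) = - (x * q ^ n * b n n)"
    using nz unfolding b_def c_Suc qpoch_Suc by simp
  have "(1 - q ^ Suc n) * (\<Sum>l\<le>Suc n. b (Suc n) l)
    = b n 0 + (\<Sum>l<n. b n (Suc l) - x * q ^ n * b n l) - x * q ^ n * b n n"
    unfolding sum.atMost_Suc sum.atMost_shift distrib_left first last sum_distrib_left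
    by (simp add: step last del: power_Suc)
  also have "\<dots> = (b n 0 + (\<Sum>l<n. b n (Suc l))) - x * q ^ n * ((\<Sum>l<n. b n l) + b n n)"
    by (simp add: sum_subtractf sum_distrib_left algebra_simps)
  also have "\<dots> = (1 - x * q ^ n) * (\<Sum>l\<le>n. b n l)"
    by (simp add: algebra_simps flip: sum.atMost_shift lessThan_Suc_atMost)
  also have "(\<Sum>l\<le>n. b n l) = (\<Prod>i<n. 1 - x * q ^ i) / qpoch n"
    using Suc.IH by (simp add: b_def c_def)
  finally have "(\<Sum>l\<le>Suc n. b (Suc n) l)
    = (1 - x * q ^ n) * ((\<Prod>i<n. 1 - x * q ^ i) / qpoch n) / (1 - q ^ Suc n)"
    using nz by (metis nonzero_mult_div_cancel_left)
  then show ?case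
    unfolding b_def c_def prod.lessThan_Suc qpoch_Suc
    by (simp add: mult.commute del: sum.atMost_Suc power_Suc)
qed

lemma qbinom_eq: "qbinom a n = (\<Prod>i<n. 1 - q powi (a - int i)) / qpoch n"
  by (simp add: qbinom_def qpoch_def prod_dividef prod.atLeast1_atMost_eq)

text \<open>The factors on the two sides have inverse powers of q in them: with
  \<open>u = q powi (c - 1 - int i)\<close>, the left one is \<open>1 - inverse u = - (1 - u) / u\<close>.\<close>

lemma prod_one_minus_q_powi_reflect:
  "(\<Prod>i<n. 1 - q powi (1 - c) * q ^ i)
    = (-1) ^ n * q powi (int (Suc n choose 2) - c * int n) * (\<Prod>i<n. 1 - q powi (c - 1 - int i))"
proof (induction n)
  case 0
  then show ?case by (simp add: numeral_2_eq_2)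
next
  case (Suc n)
  define u where "u = q powi (c - 1 - int n)"
  have u: "u \<noteq> 0" by (simp add: u_def q_nonzero)
  have "q powi (1 - c) * q ^ n = q powi (- (c - 1 - int n))"
    by (simp add: q_nonzero algebra_simps flip: power_int_of_nat power_int_add)
  then have "q powi (1 - c) * q ^ n = inverse u"
    by (simp only: u_def power_int_minus)
  then have *: "1 - q powi (1 - c) * q ^ n = - (inverse u * (1 - u))"
    using u by (simp add: algebra_simps)
  have "int (Suc (Suc n) choose 2) - c * int (Suc n)
    = (int (Suc n choose 2) - c * int n) + - (c - 1 - int n)"
    by (simp add: Suc_choose_two[of "Suc n"] algebra_simps)
  then have "q powi (int (Suc (Suc n) choose 2) - c * int (Suc n))
    = q powi (int (Suc n choose 2) - c * int n) * inverse u"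
    by (simp only: u_def power_int_add[OF disjI1[OF q_nonzero]] power_int_minus)
  then show ?case
    unfolding prod.lessThan_Suc Suc.IH * by (simp add: u_def)
qed

text \<open>The summand is that of the q-binomial theorem for \<open>x = q powi (1 - c)\<close>: the exponents
  \<open>Suc l choose 2\<close> and \<open>l choose 2\<close> differ by \<open>l\<close>, which accounts for the \<open>1\<close> in \<open>1 - c\<close>.
  Since \<open>c\<close> is any integer, the upper entry \<open>c - 1\<close> of the q-binomial coefficient may be
  negative.\<close>

lemma q_binomial_theorem_qbinom:
  "(\<Sum>l\<le>n. (-1) ^ l * q ^ (Suc l choose 2) * q powi (- (c * int l)) / (qpoch l * qpoch (n - l)))
    = (-1) ^ n * q powi (int (Suc n choose 2) - c * int n) * qbinom (c - 1) n"
proof -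
  have "q ^ (Suc l choose 2) * q powi (- (c * int l)) = q ^ (l choose 2) * (q powi (1 - c)) ^ l" for l
  proof -
    have "(q powi (1 - c)) ^ l = q powi (int l + - (c * int l))"
      by (simp add: algebra_simps flip: power_int_mult power_int_of_nat)
    also have "\<dots> = q ^ l * q powi (- (c * int l))"
      by (simp only: power_int_add[OF disjI1[OF q_nonzero]] power_int_of_nat)
    finally show ?thesis
      by (simp add: Suc_choose_two power_add)
  qed
  then show ?thesis
    using q_binomial_theorem[of "q powi (1 - c)" n]
    by (simp add: qbinom_eq prod_one_minus_q_powi_reflect mult.assoc)
qed


section \<open>The quadratic exponent\<close>

definition half_exponent :: "int ^ 'n ^ 'n \<Rightarrow> nat ^ 'n \<Rightarrow> int" where
  "half_exponent M k = (quad_form M k + diag_dot M k) div 2"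

lemma two_half_exponent:
  "transpose M = M \<Longrightarrow> 2 * half_exponent M k = quad_form M k + diag_dot M k"
  unfolding half_exponent_def by (rule dvd_mult_div_cancel[OF even_quad_form_plus_diag_dot])

lemma diag_dot_add: "diag_dot M (m + l) = diag_dot M m + diag_dot M l"
  by (simp add: diag_dot_def algebra_simps sum.distrib)

lemma int_vec_add: "int_vec (m + l) = int_vec m + int_vec l"
  by (simp add: int_vec_def vec_eq_iff)

lemma symmetric_form_commute:
  fixes A :: "int ^ 'n ^ 'n"
  assumes "transpose A = A"
  shows "(\<Sum>i\<in>UNIV. x $ i * (A *v y) $ i) = (\<Sum>i\<in>UNIV. y $ i * (A *v x) $ i)"
proof -
  have sym: "A $ i $ j = A $ j $ i" for i j
    using assms by (metis transpose_def vec_lambda_beta)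
  have "(\<Sum>i\<in>UNIV. \<Sum>j\<in>UNIV. x $ i * (A $ i $ j * y $ j))
      = (\<Sum>j\<in>UNIV. \<Sum>i\<in>UNIV. x $ i * (A $ i $ j * y $ j))"
    by (rule sum.swap)
  also have "\<dots> = (\<Sum>j\<in>UNIV. \<Sum>i\<in>UNIV. y $ j * (A $ j $ i * x $ i))"
    by (intro sum.cong refl) (simp add: sym)
  finally show ?thesis
    by (simp add: matrix_vector_mult_def sum_distrib_left)
qed

text \<open>Writing \<open>B\<close> for the symmetric bilinear form of \<open>A\<close>, the reason is
  \<open>B m m - B l l = B (m + l) (m + l) - 2 * B l (m + l)\<close>. The part that depends on the splitting of
  \<open>m + l\<close> is linear in \<open>l\<close>, which is what makes the sum over all splittings factorise.\<close>

lemma half_exponent_diff: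
  fixes A :: "int ^ 'n ^ 'n"
  assumes sym: "transpose A = A"
  shows "half_exponent A m - half_exponent A l
    = half_exponent A (m + l) - (\<Sum>j\<in>UNIV. ((A *v int_vec (m + l)) $ j + A $ j $ j) * int (l $ j))"
proof -
  define B where "B = (\<lambda>x y. \<Sum>i\<in>UNIV. int_vec x $ i * (A *v int_vec y) $ i)"
  have Q: "quad_form A x = B x x" for x
    by (simp add: quad_form_def B_def)
  have add: "B (x + y) z = B x z + B y z" "B z (x + y) = B z x + B z y" for x y z
    by (simp_all add: B_def int_vec_add matrix_vector_right_distrib algebra_simps sum.distrib)
  have comm: "B m l = B l m"
    unfolding B_def by (rule symmetric_form_commute[OF sym])
  have "(\<Sum>j\<in>UNIV. ((A *v int_vec (m + l)) $ j + A $ j $ j) * int (l $ j))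
    = B l (m + l) + diag_dot A l"
    by (simp add: B_def diag_dot_def int_vec_def algebra_simps sum.distrib)
  then show ?thesis
    using two_half_exponent[OF sym, of m] two_half_exponent[OF sym, of l]
      two_half_exponent[OF sym, of "m + l"]
    by (simp add: Q add comm diag_dot_add)
qed

lemma diag_dot_minus_identity:
  fixes A :: "int ^ 'n ^ 'n"
  shows "diag_dot (A - mat 1) k = diag_dot A k - (\<Sum>j\<in>UNIV. int (k $ j))"
  by (simp add: diag_dot_def mat_def algebra_simps sum_subtractf)

text \<open>Summed over \<open>j\<close>, the linear terms \<open>((A k)_j + A_jj) * k_j\<close> give \<open>2 * half_exponent A k\<close>,
  so that subtracting them reverses the sign of \<open>half_exponent A k\<close>; the binomial terms
  \<open>(k_j * k_j + k_j) / 2\<close> are the contribution of the identity matrix.\<close>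

lemma half_exponent_minus_identity:
  fixes A :: "int ^ 'n ^ 'n"
  assumes sym: "transpose A = A"
  shows "- half_exponent (A - mat 1) k = half_exponent A k
    + (\<Sum>j\<in>UNIV. int (Suc (k $ j) choose 2) - ((A *v int_vec k) $ j + A $ j $ j) * int (k $ j))"
proof -
  have "transpose (A - mat 1) = A - mat 1"
    using sym by (simp add: vec_eq_iff transpose_def mat_def)
  note e = two_half_exponent[OF sym, of k] two_half_exponent[OF this, of k]
  have "quad_form (A - mat 1) k = quad_form A k - (\<Sum>j\<in>UNIV. int (k $ j) * int (k $ j))"
    by (simp add: quad_form_def matrix_vector_mult_diff_rdistrib int_vec_def algebra_simps sum_subtractf)
  moreover have "(\<Sum>j\<in>UNIV. ((A *v int_vec k) $ j + A $ j $ j) * int (k $ j))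
    = quad_form A k + diag_dot A k"
    by (simp add: quad_form_def diag_dot_def int_vec_def algebra_simps sum.distrib)
  moreover have "2 * int (Suc n choose 2) = int n * int n + int n" for n
    by (induction n) (simp_all add: Suc_choose_two algebra_simps)
  then have "2 * (\<Sum>j\<in>UNIV. int (Suc (k $ j) choose 2))
    = (\<Sum>j\<in>UNIV. int (k $ j) * int (k $ j)) + (\<Sum>j\<in>UNIV. int (k $ j))"
    by (simp add: sum_distrib_left sum.distrib)
  ultimately show ?thesis
    using e by (simp add: diag_dot_minus_identity sum_subtractf)
qed


section \<open>Coefficients of the product of the two series\<close>

lemma powi_sum:
  fixes x :: "'a :: field"
  assumes "x \<noteq> 0"
  shows "x powi (\<Sum>i\<in>S. g i) = (\<Prod>i\<in>S. x powi g i)"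
  by (induction S rule: infinite_finite_induct) (simp_all add: assms power_int_add)

text \<open>A splitting \<open>m + l = k\<close> is the same as a choice of \<open>l $ j \<le> k $ j\<close> for every \<open>j\<close>,
  so the product of sums expands into the sum over all splittings.\<close>

lemma sum_vec_splittings:
  fixes k :: "nat ^ 'n" and g :: "'n \<Rightarrow> nat \<Rightarrow> 'a :: comm_semiring_1"
  shows "(\<Sum>(m, l) | m + l = k. \<Prod>j\<in>UNIV. g j (l $ j)) = (\<Prod>j\<in>UNIV. \<Sum>i\<le>k $ j. g j i)"
proof -
  have "(\<Prod>j\<in>UNIV. \<Sum>i\<le>k $ j. g j i)
    = (\<Sum>h\<in>(\<Pi>\<^sub>E j\<in>UNIV. {..k $ j}). \<Prod>j\<in>UNIV. g j (h j))"
    by (rule prod_sum_PiE) auto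
  also have "\<dots> = (\<Sum>(m, l) | m + l = k. \<Prod>j\<in>UNIV. g j (l $ j))"
    by (rule sum.reindex_bij_witness[where i = "\<lambda>(m, l). ($) l" and j = "\<lambda>h. (k - vec_lambda h, vec_lambda h)"])
      (auto simp: PiE_iff vec_eq_iff, (metis add_diff_cancel_right' le_add2)+)
  finally show ?thesis by simp
qed

lemma f_series_coeff:
  "mfps_coeff (f_series A) n
    = (-1) powi diag_dot A n * q powi half_exponent A n / (\<Prod>i\<in>UNIV. qpoch (n $ i))"
  by (simp add: f_series_def half_exponent_def Abs_mfps_inverse)

lemma f_series_coeff_qinv:
  "subst_qinv (mfps_coeff (f_series A) n)
    = (-1) powi diag_dot A n * q powi (- half_exponent A n)
        * (\<Prod>i\<in>UNIV. (-1) ^ (n $ i) * q ^ (Suc (n $ i) choose 2) / qpoch (n $ i))"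
proof -
  have "inverse (subst_qinv (qpoch n)) = (-1) ^ n * q ^ (Suc n choose 2) / qpoch n" for n
    by (cases "even n") (simp_all add: subst_qinv_qpoch)
  then have "inverse (\<Prod>i\<in>UNIV. subst_qinv (qpoch (n $ i)))
    = (\<Prod>i\<in>UNIV. (-1) ^ (n $ i) * q ^ (Suc (n $ i) choose 2) / qpoch (n $ i))"
    by (simp flip: prod_inversef)
  moreover have "subst_qinv (mfps_coeff (f_series A) n)
    = (-1) powi diag_dot A n * q powi (- half_exponent A n)
        * inverse (\<Prod>i\<in>UNIV. subst_qinv (qpoch (n $ i)))"
    unfolding f_series_coeff subst_qinv_divide subst_qinv_mult subst_qinv_powi subst_qinv_prod
    by (simp add: subst_qinv_uminus divide_inverse power_int_minus power_int_inverse)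
  ultimately show ?thesis
    by simp
qed

text \<open>The factor in front of the product depends on \<open>k\<close> alone, and the factor for \<open>j\<close> only on
  \<open>k\<close> and \<open>l $ j\<close>: this is the form to which \<open>sum_vec_splittings\<close> applies.\<close>

lemma f_sym_term:
  fixes A :: "int ^ 'n ^ 'n"
  assumes "transpose A = A" and "m + l = k"
  shows "mfps_coeff (f_series A) m * subst_qinv (mfps_coeff (f_series A) l)
    = (-1) powi diag_dot A k * q powi half_exponent A k
      * (\<Prod>j\<in>UNIV. (-1) ^ (l $ j) * q ^ (Suc (l $ j) choose 2)
          * q powi (- (((A *v int_vec k) $ j + A $ j $ j) * int (l $ j)))
          / (qpoch (l $ j) * qpoch (k $ j - l $ j)))"
proof -
  define c where "c = (\<lambda>j. (A *v int_vec k) $ j + A $ j $ j)"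
  have m: "k $ j - l $ j = m $ j" for j
    using assms(2) by auto
  have "q powi half_exponent A m * q powi (- half_exponent A l)
    = q powi (half_exponent A k + (\<Sum>j\<in>UNIV. - (c j * int (l $ j))))"
    using half_exponent_diff[OF assms(1), of m l]
    by (simp add: q_nonzero assms(2) c_def sum_negf flip: power_int_add)
  also have "\<dots> = q powi half_exponent A k * (\<Prod>j\<in>UNIV. q powi (- (c j * int (l $ j))))"
    by (simp add: power_int_add q_nonzero powi_sum)
  finally have e: "q powi half_exponent A m * q powi (- half_exponent A l)
    = q powi half_exponent A k * (\<Prod>j\<in>UNIV. q powi (- (c j * int (l $ j))))" .
  have s: "(-1 :: ratfun) powi diag_dot A k = (-1) powi diag_dot A m * (-1) powi diag_dot A l"
    by (simp add: diag_dot_add power_int_add flip: assms(2))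
  have "mfps_coeff (f_series A) m * subst_qinv (mfps_coeff (f_series A) l)
    = (-1) powi diag_dot A k * (q powi half_exponent A m * q powi (- half_exponent A l))
      * ((\<Prod>j\<in>UNIV. (-1) ^ (l $ j) * q ^ (Suc (l $ j) choose 2) / qpoch (l $ j))
        / (\<Prod>j\<in>UNIV. qpoch (m $ j)))"
    unfolding f_series_coeff_qinv unfolding f_series_coeff s by (simp add: mult_ac)
  then show ?thesis
    unfolding e m c_def by (simp add: prod.distrib prod_dividef)
qed

theorem proposition1p14:
  fixes A :: "int ^ 'n ^ 'n"
  assumes "transpose A = A"
  shows "f_sym A = Abs_mfps (\<lambda>k.
    (-1) powi diag_dot (A - mat 1) k
      * q powi (- ((quad_form (A - mat 1) k + diag_dot (A - mat 1) k) div 2))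
      * (\<Prod>j\<in>UNIV. qbinom ((A *v int_vec k) $ j + A $ j $ j - 1) (k $ j)))"
proof -
  have "(\<Sum>(m, l) | m + l = k. mfps_coeff (f_series A) m * subst_qinv (mfps_coeff (f_series A) l))
    = (-1) powi diag_dot (A - mat 1) k * q powi (- half_exponent (A - mat 1) k)
      * (\<Prod>j\<in>UNIV. qbinom ((A *v int_vec k) $ j + A $ j $ j - 1) (k $ j))" for k
  proof -
    define c where "c = (\<lambda>j. (A *v int_vec k) $ j + A $ j $ j)"
    have "(\<Sum>(m, l) | m + l = k. mfps_coeff (f_series A) m * subst_qinv (mfps_coeff (f_series A) l))
      = (\<Sum>(m, l) | m + l = k. (-1) powi diag_dot A k * q powi half_exponent A k
          * (\<Prod>j\<in>UNIV. (-1) ^ (l $ j) * q ^ (Suc (l $ j) choose 2) * q powi (- (c j * int (l $ j)))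
              / (qpoch (l $ j) * qpoch (k $ j - l $ j))))"
      unfolding c_def by (rule sum.cong) (auto simp: f_sym_term[OF assms])
    also have "\<dots> = (-1) powi diag_dot A k * q powi half_exponent A k
      * (\<Sum>(m, l) | m + l = k. \<Prod>j\<in>UNIV. (-1) ^ (l $ j) * q ^ (Suc (l $ j) choose 2)
          * q powi (- (c j * int (l $ j))) / (qpoch (l $ j) * qpoch (k $ j - l $ j)))"
      by (simp add: sum_distrib_left case_prod_unfold)
    also have "\<dots> = (-1) powi diag_dot A k * q powi half_exponent A k
      * (\<Prod>j\<in>UNIV. (-1) ^ (k $ j) * q powi (int (Suc (k $ j) choose 2) - c j * int (k $ j))
          * qbinom (c j - 1) (k $ j))"
      by (subst sum_vec_splittings) (simp only: q_binomial_theorem_qbinom)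
    also have "\<dots> = ((-1) powi diag_dot A k * (\<Prod>j\<in>UNIV. (-1) ^ (k $ j)))
      * (q powi half_exponent A k * (\<Prod>j\<in>UNIV. q powi (int (Suc (k $ j) choose 2) - c j * int (k $ j))))
      * (\<Prod>j\<in>UNIV. qbinom (c j - 1) (k $ j))"
      by (simp add: prod.distrib)
    also have "(-1) powi diag_dot A k * (\<Prod>j\<in>UNIV. (-1) ^ (k $ j))
      = ((-1) powi diag_dot (A - mat 1) k :: ratfun)"
    proof -
      have "(-1 :: ratfun) powi - (\<Sum>j\<in>UNIV. int (k $ j)) = (\<Prod>j\<in>UNIV. (-1) ^ (k $ j))"
        by (simp add: power_int_minus powi_sum flip: prod_inversef power_inverse)
      then show ?thesis
        using power_int_add[of "-1 :: ratfun" "diag_dot A k" "- (\<Sum>j\<in>UNIV. int (k $ j))"]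
        by (simp add: diag_dot_minus_identity)
    qed
    also have "q powi half_exponent A k
        * (\<Prod>j\<in>UNIV. q powi (int (Suc (k $ j) choose 2) - c j * int (k $ j)))
      = q powi (- half_exponent (A - mat 1) k)"
      unfolding half_exponent_minus_identity[OF assms] c_def
      by (simp only: power_int_add[OF disjI1[OF q_nonzero]] powi_sum[OF q_nonzero])
    finally show ?thesis
      by (simp only: c_def)
  qed
  then show ?thesis
    by (simp add: f_sym_def times_mfps_def map_mfps_def Abs_mfps_inverse half_exponent_def)
qed

end
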